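(* Let $Q\in\mathbb{R}^{m\times m}$ be symmetric positive definite, $p\in\mathbb{R}^m$ with $p\neq0$, $b\in\mathbb{R}$, $X:=\{x\in\mathbb{R}^m: p^\top x=b\}$, and $A:=Q^{-1}-\frac{1}{p^\top Q^{-1}p}Q^{-1}p(Q^{-1}p)^\top$. Then for any $d\in\mathbb{R}^m$ the optimal solution to $\min_{x\in X}\{\frac12x^\top Qx-d^\top x\}$ is $$x^*(d)=Ad+\frac{b}{p^\top Q^{-1}p}Q^{-1}p.$$ Furthermore, for all $d,c\in\mathbb{R}^m$, $$L(d,c):=\tfrac12x^*(d)^\top Qx^*(d)-c^\top x^*(d)-\min_{x\in X}\left\{\tfrac12x^\top Qx-c^\top x\right\}=\tfrac12(d-c)^\top A(d-c).$$ Consequently, $$\ell_{\mathrm{SPO+}}(d,c)=L(c,2d-c)=2(c-d)^\top A(c-d)=4L(d,c).$$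
   Context: For objectives of the form $f(x)-c^\top x$ with $f(x)=\frac12x^\top Qx$, the SPO+ loss is defined by $\ell_{\mathrm{SPO+}}(d,c):=f(x^*(c))-(2d-c)^\top x^*(c)-\min_{x\in X}\{f(x)-(2d-c)^\top x\}$, where $x^*(d)$ denotes the minimizer of $f(x)-d^\top x$ over $x\in X$. *)

theory Defs
  imports "HOL-Analysis.Analysis"
begin

definition sym_pos_def :: "real ^ 'm ^ 'm \<Rightarrow> bool" where
  "sym_pos_def Q \<longleftrightarrow> transpose Q = Q \<and> (\<forall>x. x \<noteq> 0 \<longrightarrow> x \<bullet> (Q *v x) > 0)"

definition outer_square :: "real ^ 'm \<Rightarrow> real ^ 'm ^ 'm" where
  "outer_square v = (\<chi> i j. v $ i * v $ j)"

(* Minimizer of f x - d \<bullet> x over X; an arbitrary choice unless it exists and is unique. *)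
definition opt_sol :: "('v::real_inner \<Rightarrow> real) \<Rightarrow> 'v set \<Rightarrow> 'v \<Rightarrow> 'v" where
  "opt_sol f X d = arg_min_on (\<lambda>x. f x - d \<bullet> x) X"

(* Real infimum: it is the minimum whenever a minimizer exists, and has no meaning
   if X is empty or the objective is unbounded below on X. *)
definition opt_val :: "('v::real_inner \<Rightarrow> real) \<Rightarrow> 'v set \<Rightarrow> 'v \<Rightarrow> real" where
  "opt_val f X d = (INF x\<in>X. f x - d \<bullet> x)"

definition regret :: "('v::real_inner \<Rightarrow> real) \<Rightarrow> 'v set \<Rightarrow> 'v \<Rightarrow> 'v \<Rightarrow> real" where
  "regret f X d c = f (opt_sol f X d) - c \<bullet> opt_sol f X d - opt_val f X c"

definition spo_plus_loss :: "('v::real_inner \<Rightarrow> real) \<Rightarrow> 'v set \<Rightarrow> 'v \<Rightarrow> 'v \<Rightarrow> real" where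
  "spo_plus_loss f X d c =
     f (opt_sol f X c) - (2 *\<^sub>R d - c) \<bullet> opt_sol f X c - opt_val f X (2 *\<^sub>R d - c)"

end

theory Submission
  imports Defs
begin

text \<open>
  Put \<open>q = Q\<^sup>-\<^sup>1 p\<close> and let \<open>z d\<close> be the claimed minimizer. It lies in \<open>X\<close>, and the gradient
  \<open>Q (z d) - d\<close> is a multiple of \<open>p\<close>, hence orthogonal to all differences of points of \<open>X\<close>. So on \<open>X\<close>
  the objective exceeds its value at \<open>z d\<close> by exactly \<open>1/2 (y - z d) \<bullet> Q (y - z d)\<close>. As
  \<open>z d - z c = A (d - c)\<close>, the regret formula reduces to \<open>A Q A = A\<close>.
\<close>

lemma sym_pos_def_inner_commute:
  assumes "sym_pos_def Q"
  shows "x \<bullet> (Q *v y) = (Q *v x) \<bullet> y"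
  using assms dot_lmul_matrix[of x Q y] transpose_matrix_vector[of Q x]
  by (simp add: sym_pos_def_def)

lemma sym_pos_def_inner_pos:
  assumes "sym_pos_def Q" "x \<noteq> 0"
  shows "x \<bullet> (Q *v x) > 0"
  using assms by (simp add: sym_pos_def_def)

text \<open>Definiteness forces the kernel of \<open>Q\<close> to be trivial, so \<open>Q\<close> is
  invertible. Since \<open>matrix_inv\<close> is a Hilbert choice, its defining property has to be
  extracted with \<open>someI2_ex\<close>.\<close>

lemma sym_pos_def_mult_matrix_inv:
  fixes Q :: "real ^ 'm ^ 'm"
  assumes "sym_pos_def Q"
  shows "Q *v (matrix_inv Q *v x) = x"
proof -
  have "x = 0" if "Q *v x = 0" for x
    using assms that sym_pos_def_inner_pos[of Q x] by auto
  then have "invertible Q"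
    by (simp add: invertible_left_inverse matrix_left_invertible_ker)
  then have "Q ** matrix_inv Q = mat 1"
    unfolding invertible_def matrix_inv_def by (rule someI2_ex) blast
  then show ?thesis
    by (simp add: matrix_vector_mul_assoc)
qed

lemma outer_square_mult: "outer_square v *v x = (v \<bullet> x) *\<^sub>R v"
  by (simp add: vec_eq_iff outer_square_def matrix_vector_mult_def inner_vec_def
      sum_distrib_left mult_ac)

text \<open>This is the second-order Taylor expansion at \<open>z\<close>, exact for a quadratic;
  symmetry of \<open>Q\<close> merges the two cross terms.\<close>

lemma quadratic_expansion:
  fixes Q :: "real ^ 'm ^ 'm"
  assumes "sym_pos_def Q"
  shows "1 / 2 * (y \<bullet> (Q *v y)) - d \<bullet> y =
    1 / 2 * (z \<bullet> (Q *v z)) - d \<bullet> z + (Q *v z - d) \<bullet> (y - z) + 1 / 2 * ((y - z) \<bullet> (Q *v (y - z)))"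
  using sym_pos_def_inner_commute[OF assms, of z y]
  by (simp add: matrix_vector_mult_diff_distrib inner_diff_left inner_diff_right inner_commute
      algebra_simps)

text \<open>\<open>arg_min\<close> is a Hilbert choice, so it is pinned down only once
  \<open>z\<close> is known to be the unique minimizer.\<close>

lemma opt_sol_eqI:
  assumes "\<And>x. is_arg_min (\<lambda>y. f y - d \<bullet> y) (\<lambda>y. y \<in> X) x \<longleftrightarrow> x = z"
  shows "opt_sol f X d = z"
  using assms by (simp add: opt_sol_def arg_min_on_def arg_min_def)

lemma opt_val_eqI:
  assumes "z \<in> X" "\<And>y. y \<in> X \<Longrightarrow> f z - d \<bullet> z \<le> f y - d \<bullet> y"
  shows "opt_val f X d = f z - d \<bullet> z"
  unfolding opt_val_def using assms by (intro cInf_eq_minimum) auto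

theorem proposition3:
  fixes Q A :: "real ^ 'm ^ 'm" and p :: "real ^ 'm" and b :: real
    and X :: "(real ^ 'm) set" and f :: "real ^ 'm \<Rightarrow> real"
  assumes Q: "sym_pos_def Q"
    and p: "p \<noteq> 0"
    and X: "X = {x. p \<bullet> x = b}"
    and A: "A = matrix_inv Q -
              (1 / (p \<bullet> (matrix_inv Q *v p))) *\<^sub>R outer_square (matrix_inv Q *v p)"
    and f: "f = (\<lambda>x. 1 / 2 * (x \<bullet> (Q *v x)))"
  shows "(\<forall>d. (\<forall>x. is_arg_min (\<lambda>y. f y - d \<bullet> y) (\<lambda>y. y \<in> X) x \<longleftrightarrow> x = opt_sol f X d) \<and>
              opt_sol f X d =
                A *v d + (b / (p \<bullet> (matrix_inv Q *v p))) *\<^sub>R (matrix_inv Q *v p)) \<and>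
         (\<forall>d c. regret f X d c = 1 / 2 * ((d - c) \<bullet> (A *v (d - c)))) \<and>
         (\<forall>d c. spo_plus_loss f X d c = regret f X c (2 *\<^sub>R d - c) \<and>
                regret f X c (2 *\<^sub>R d - c) = 2 * ((c - d) \<bullet> (A *v (c - d))) \<and>
                2 * ((c - d) \<bullet> (A *v (c - d))) = 4 * regret f X d c)"
proof -
  define q where "q = matrix_inv Q *v p"
  define s where "s = p \<bullet> q"
  define z where "z d = A *v d + (b / s) *\<^sub>R q" for d
  have Qq: "Q *v q = p"
    unfolding q_def by (rule sym_pos_def_mult_matrix_inv[OF Q])
  have "q \<noteq> 0"
    using Qq p by auto
  \<comment> \<open>Since \<open>p = Q *v q\<close>, \<open>s\<close> is the quadratic form of
    \<open>Q\<close> at \<open>q\<close>.\<close>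
  then have s: "s > 0"
    using sym_pos_def_inner_pos[OF Q, of q] Qq by (simp add: s_def inner_commute)
  have Av: "A *v v = matrix_inv Q *v v - (q \<bullet> v / s) *\<^sub>R q" for v
    by (simp add: A flip: q_def s_def)
      (simp add: matrix_vector_mult_diff_rdistrib scaleR_matrix_vector_assoc[symmetric]
        outer_square_mult)
  \<comment> \<open>\<open>Q ** A\<close> is thus the projection along \<open>p\<close> onto the
    orthogonal complement of \<open>q\<close>.\<close>
  have QAv: "Q *v (A *v v) = v - (q \<bullet> v / s) *\<^sub>R p" for v
    by (simp add: Av matrix_vector_mult_diff_distrib sym_pos_def_mult_matrix_inv[OF Q]
        matrix_vector_mult_scaleR Qq)
  have pAv: "p \<bullet> (A *v v) = 0" for v
  proof -
    have "p \<bullet> (A *v v) = q \<bullet> (Q *v (A *v v))"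
      by (simp add: sym_pos_def_inner_commute[OF Q] Qq)
    then show ?thesis
      using s by (simp add: QAv inner_diff_right s_def inner_commute)
  qed
  \<comment> \<open>\<open>Q *v (A *v v)\<close> differs from \<open>v\<close> by a multiple of
    \<open>p\<close>, which is orthogonal to \<open>A *v v\<close>.\<close>
  have AQA: "(A *v v) \<bullet> (Q *v (A *v v)) = v \<bullet> (A *v v)" for v
    using pAv[of v] by (simp add: QAv inner_diff_right inner_commute)
  have zX: "z d \<in> X" for d
    using s by (simp add: X z_def inner_add_right pAv flip: s_def)
  have excess: "f y - d \<bullet> y = f (z d) - d \<bullet> z d + 1 / 2 * ((y - z d) \<bullet> (Q *v (y - z d)))"
    if "y \<in> X" for y d
  proof -
    have "Q *v z d - d = (b / s - q \<bullet> d / s) *\<^sub>R p"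
      by (simp add: z_def matrix_vector_right_distrib QAv matrix_vector_mult_scaleR Qq
          scaleR_diff_left)
    moreover have "p \<bullet> (y - z d) = 0"
      using that zX[of d] by (simp add: X inner_diff_right)
    ultimately show ?thesis
      using quadratic_expansion[OF Q, of y d "z d"] by (simp add: f)
  qed
  have le: "f (z d) - d \<bullet> z d \<le> f y - d \<bullet> y" if "y \<in> X" for y d
    using excess[OF that, of d] sym_pos_def_inner_pos[OF Q, of "y - z d"]
    by (cases "y = z d") auto
  have less: "f (z d) - d \<bullet> z d < f y - d \<bullet> y" if "y \<in> X" "y \<noteq> z d" for y d
    using excess[OF that(1), of d] sym_pos_def_inner_pos[OF Q, of "y - z d"] that(2) by auto
  have argmin: "is_arg_min (\<lambda>y. f y - d \<bullet> y) (\<lambda>y. y \<in> X) x \<longleftrightarrow> x = z d" for d x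
    unfolding is_arg_min_linorder using le less zX by (metis not_less)
  have sol: "opt_sol f X d = z d" for d
    using argmin by (rule opt_sol_eqI)
  have val: "opt_val f X d = f (z d) - d \<bullet> z d" for d
    using zX le by (rule opt_val_eqI)
  have regret: "regret f X d c = 1 / 2 * ((d - c) \<bullet> (A *v (d - c)))" for d c
  proof -
    have "z d - z c = A *v (d - c)"
      by (simp add: z_def matrix_vector_mult_diff_distrib)
    then show ?thesis
      \<comment> \<open>The regret is the excess of the feasible point \<open>z d\<close> over the
        minimizer \<open>z c\<close> for the cost \<open>c\<close>.\<close>
      using excess[OF zX, of d c] by (simp add: regret_def sol val AQA)
  qed
  have regret_reflect: "regret f X c (2 *\<^sub>R d - c) = 2 * ((c - d) \<bullet> (A *v (c - d)))" for c d
  proof -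
    have "c - (2 *\<^sub>R d - c) = 2 *\<^sub>R (c - d)"
      by (simp add: scaleR_2 algebra_simps)
    then show ?thesis
      by (simp only: regret) (simp add: matrix_vector_mult_scaleR)
  qed
  have regret_scaled: "2 * ((c - d) \<bullet> (A *v (c - d))) = 4 * regret f X d c" for c d
    by (simp add: regret matrix_vector_mult_diff_distrib inner_diff_left inner_diff_right)
  \<comment> \<open>Both sides unfold to the same expression: the decision is made for
    \<open>c\<close> and evaluated under the cost \<open>2 *\<^sub>R d - c\<close>.\<close>
  have spo: "spo_plus_loss f X d c = regret f X c (2 *\<^sub>R d - c)" for d c
    by (simp add: spo_plus_loss_def regret_def)
  show ?thesis
    \<comment> \<open>Only the goals about the minimizer mention \<open>opt_sol\<close>, so the
      unfolding is optional.\<close>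
    by (intro conjI allI; (unfold sol)?)
      (fact argmin z_def[unfolded s_def q_def] regret spo regret_reflect regret_scaled)+
qed

end
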